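(* Let $\mathbf{D}$ be a nonempty set of rooted communication graphs on $n$ processes and let $i\ge1$. If $\mathcal{N}_i(\mathbf{D})$ contains a connected component that is not root-compatible, then for every consensus algorithm that is correct under the oblivious message adversary $\mathbf{D}$, it is not the case that in all runs all processes have decided by the end of round $i$ (that is, there is a run in which some process has not decided by the end of round $i$).
   Context: **Model.** $\Pi=\{p_1,\dots,p_n\}$ is a set of $n$ processes. A communication graph is a directed graph on $\Pi$ containing all self-loops; $\mathrm{In}_G(p)=\{q:(q,p)\in E(G)\}$. An oblivious message adversary is given by a nonempty set $\mathbf{D}$ of communication graphs; its admissible infinite communication patterns are all sequences $\sigma=(\sigma(1),\sigma(2),\dots)\in\mathbf{D}^\omega$ with every $\sigma(r)\in\mathbf{D}$. Given inputs $(x_p)_{p\in\Pi}$, views are defined by $\mathrm{view}_\sigma(p,0)=\{(p,0,x_p)\}$ and, for $r\ge1$, $\mathrm{view}_\sigma(p,r)=(p,r,\{\mathrm{view}_\sigma(q,r-1):(q,p)\in\sigma(r)\})$. **Consensus.** Each process $p$ has an input $x_p$ from a finite domain $V$ with $|V|\ge2$; all input assignments are possible. A (deterministic, full-information) consensus algorithm is a family of decision functions $\Delta_p$ mapping each possible view of $p$ to $V\cup\{\bot\}$ such that if $\Delta_p(\mathrm{view}_\sigma(p,r))\ne\bot$ then $\Delta_p(\mathrm{view}_\sigma(p,r'))=\Delta_p(\mathrm{view}_\sigma(p,r))$ for all $r'\ge r$. A run is determined by an input assignment and some $\sigma\in\mathbf{D}^\omega$; $p$ has decided $v\neq\bot$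 by (the end of) round $r$ if $\Delta_p(\mathrm{view}_\sigma(p,r))=v$. The algorithm is correct under $\mathbf{D}$ if in every run every process eventually decides (termination), no two processes decide differently (agreement), and every decided value is the input of some process (validity). **Roots.** A root component of a graph is a strongly connected component with no incoming edge from outside. A graph $G$ is rooted if it has exactly one root component, whose node set is $\mathrm{Root}(G)$. A set $\mathbf{S}$ of rooted communication graphs is root-compatible if $\bigcap_{G\in\mathbf{S}}\mathrm{Root}(G)\ne\emptyset$. **Refined indistinguishability graphs.** $I(\mathbf{D})$ is the undirected graph with node set $\mathbf{D}$ in which $G,H$ are joined by an edge $e$ iff its label $\ell(e)=\{p\in\Pi:\mathrm{In}_G(p)=\mathrm{In}_H(p)\}$ is nonempty. Put $\mathcal{N}_1=I(\mathbf{D})$. For $i\ge2$, $\mathcal{N}_i=\mathcal{N}_i(\mathbf{D})$ has node set $\mathbf{D}$, and its edges are those edges $e$ of $\mathcal{N}_{i-1}$ for which the connected component of $\mathcal{N}_{i-1}$ containing $e$ contains a node $G$ with $\mathrm{Root}(G)\subseteq\ell(e)$. *)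

theory Defs
  imports Complex_Main "HOL-Library.FSet"
begin

text \<open>The processes are the elements of a finite type \<^typ>\<open>'p\<close>, the input domain is a
  type \<^typ>\<open>'v\<close>. A communication graph is a relation on \<^typ>\<open>'p\<close>; \<^prop>\<open>(q, p) \<in> G\<close> means that
  \<^term>\<open>p\<close> hears from \<^term>\<open>q\<close>.\<close>

definition comm_graph :: "'p rel \<Rightarrow> bool" where
  "comm_graph G \<longleftrightarrow> refl G"

definition In_nbrs :: "'p rel \<Rightarrow> 'p \<Rightarrow> 'p set" where
  "In_nbrs G p = {q. (q, p) \<in> G}"

subsection \<open>Root components\<close>

definition sccs :: "'p rel \<Rightarrow> 'p set set" where
  "sccs G = UNIV // (G\<^sup>* \<inter> (G\<^sup>*)\<inverse>)"

definition root_component :: "'p rel \<Rightarrow> 'p set \<Rightarrow> bool" where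
  "root_component G C \<longleftrightarrow> C \<in> sccs G \<and> \<not> (\<exists>(q, p) \<in> G. q \<notin> C \<and> p \<in> C)"

definition rooted :: "'p rel \<Rightarrow> bool" where
  "rooted G \<longleftrightarrow> (\<exists>!C. root_component G C)"

text \<open>Meaningful only if \<^term>\<open>rooted G\<close>.\<close>

definition Root :: "'p rel \<Rightarrow> 'p set" where
  "Root G = (THE C. root_component G C)"

definition root_compatible :: "'p rel set \<Rightarrow> bool" where
  "root_compatible S \<longleftrightarrow> (\<Inter>G\<in>S. Root G) \<noteq> {}"

subsection \<open>Refined indistinguishability graphs\<close>

text \<open>An undirected graph with node set \<open>D\<close> is represented by its (symmetric) adjacency
  relation \<open>E\<close>, so that \<open>E\<^sup>*\<close> relates the nodes lying in the same connected component.\<close>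

definition conn_components :: "'a set \<Rightarrow> 'a rel \<Rightarrow> 'a set set" where
  "conn_components D E = D // E\<^sup>*"

definition label :: "'p rel \<Rightarrow> 'p rel \<Rightarrow> 'p set" where
  "label G H = {p. In_nbrs G p = In_nbrs H p}"

definition indist_graph :: "'p rel set \<Rightarrow> 'p rel rel" where
  "indist_graph D = {(G, H). G \<in> D \<and> H \<in> D \<and> G \<noteq> H \<and> label G H \<noteq> {}}"

definition refine :: "'p rel set \<Rightarrow> 'p rel rel \<Rightarrow> 'p rel rel" where
  "refine D E = {(G, H) \<in> E.
     \<exists>C \<in> conn_components D E. G \<in> C \<and> H \<in> C \<and> (\<exists>K \<in> C. Root K \<subseteq> label G H)}"

text \<open>Indexed from 1 on; the value at index 0 is irrelevant.\<close>

definition refined_graph :: "'p rel set \<Rightarrow> nat \<Rightarrow> 'p rel rel" where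
  "refined_graph D i = (refine D ^^ (i - 1)) (indist_graph D)"

subsection \<open>Views and consensus\<close>

datatype ('p, 'v) view =
    Initial_View 'p nat 'v
  | Round_View 'p nat "('p, 'v) view fset"

text \<open>Rounds are numbered from 1 on, so the value of a pattern at 0 is irrelevant.\<close>

definition admissible :: "'p rel set \<Rightarrow> (nat \<Rightarrow> 'p rel) set" where
  "admissible D = {\<sigma>. \<forall>r\<ge>1. \<sigma> r \<in> D}"

primrec view_of ::
    "(nat \<Rightarrow> 'p rel) \<Rightarrow> ('p \<Rightarrow> 'v) \<Rightarrow> ('p::finite) \<Rightarrow> nat \<Rightarrow> ('p, 'v) view" where
  "view_of \<sigma> x p 0 = Initial_View p 0 (x p)"
| "view_of \<sigma> x p (Suc r) =
     Round_View p (Suc r)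
       (fimage (\<lambda>q. view_of \<sigma> x q r) (ffilter (\<lambda>q. q \<in> In_nbrs (\<sigma> (Suc r)) p) fUNIV))"

text \<open>An algorithm is a family of decision functions, where \<^const>\<open>None\<close> stands for the
  undecided value.\<close>

type_synonym ('p, 'v) decision_functions = "'p \<Rightarrow> ('p, 'v) view \<Rightarrow> 'v option"

definition consensus_algorithm ::
    "('p::finite) rel set \<Rightarrow> ('p, 'v) decision_functions \<Rightarrow> bool" where
  "consensus_algorithm D \<Delta> \<longleftrightarrow>
     (\<forall>\<sigma> \<in> admissible D. \<forall>x p r r'.
        \<Delta> p (view_of \<sigma> x p r) \<noteq> None \<longrightarrow> r \<le> r' \<longrightarrow>
        \<Delta> p (view_of \<sigma> x p r') = \<Delta> p (view_of \<sigma> x p r))"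

definition decided_by ::
    "('p, 'v) decision_functions \<Rightarrow> (nat \<Rightarrow> 'p rel) 
     \<Rightarrow> ('p \<Rightarrow> 'v) \<Rightarrow> ('p::finite) \<Rightarrow> nat \<Rightarrow> 'v \<Rightarrow> bool" where
  "decided_by \<Delta> \<sigma> x p r v \<longleftrightarrow> \<Delta> p (view_of \<sigma> x p r) = Some v"

definition sat_termination :: "('p::finite) rel set \<Rightarrow> ('p, 'v) decision_functions \<Rightarrow> bool" where
  "sat_termination D \<Delta> \<longleftrightarrow>
     (\<forall>\<sigma> \<in> admissible D. \<forall>x p. \<exists>r v. decided_by \<Delta> \<sigma> x p r v)"

definition sat_agreement :: "('p::finite) rel set \<Rightarrow> ('p, 'v) decision_functions \<Rightarrow> bool" where
  "sat_agreement D \<Delta> \<longleftrightarrow>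
     (\<forall>\<sigma> \<in> admissible D. \<forall>x p q r s v w.
        decided_by \<Delta> \<sigma> x p r v \<longrightarrow> decided_by \<Delta> \<sigma> x q s w \<longrightarrow> v = w)"

definition sat_validity :: "('p::finite) rel set \<Rightarrow> ('p, 'v) decision_functions \<Rightarrow> bool" where
  "sat_validity D \<Delta> \<longleftrightarrow>
     (\<forall>\<sigma> \<in> admissible D. \<forall>x p r v. decided_by \<Delta> \<sigma> x p r v \<longrightarrow> (\<exists>q. v = x q))"

definition correct :: "('p::finite) rel set \<Rightarrow> ('p, 'v) decision_functions \<Rightarrow> bool" where
  "correct D \<Delta> \<longleftrightarrow> sat_termination D \<Delta> \<and> sat_agreement D \<Delta> \<and> sat_validity D \<Delta>"

end

theory Submission
  imports Defs
begin

text \<open>Suppose that everybody has decided by round \<open>i\<close>, so that the first \<open>i\<close> graphs and the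
  inputs determine a common decision value. By induction on \<open>m\<close>, replacing \<open>G\<^sup>m\<close> by \<open>H\<^sup>m\<close> in the
  last \<open>m\<close> of these rounds does not change the value if \<open>G\<close> and \<open>H\<close> are in the same component of
  \<open>\<N>\<^sub>m\<close>: for an edge of \<open>\<N>\<^sub>m\<close> with label containing \<open>Root K\<close>, pass from \<open>G G\<^sup>m\<^sup>-\<^sup>1\<close> to
  \<open>G K\<^sup>m\<^sup>-\<^sup>1\<close> and from \<open>H K\<^sup>m\<^sup>-\<^sup>1\<close> to \<open>H H\<^sup>m\<^sup>-\<^sup>1\<close> by the induction hypothesis; \<open>G K\<^sup>m\<^sup>-\<^sup>1\<close> and
  \<open>H K\<^sup>m\<^sup>-\<^sup>1\<close> cannot be told apart by \<open>Root K\<close>, which never hears from outside. Hence the value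
  is the same under \<open>G\<^sup>i\<close> for all \<open>G\<close> in a component of \<open>\<N>\<^sub>i\<close>. Since under \<open>G\<^sup>i\<close> it depends on the
  inputs of \<open>Root G\<close> only, it depends only on the inputs of the intersection of the roots. If this
  intersection is empty, the value is constant, which contradicts validity.\<close>

lemma rooted_imp_root_component: "rooted G \<Longrightarrow> root_component G (Root G)"
  unfolding rooted_def Root_def by (rule theI')

lemma Root_nonempty:
  assumes "rooted G"
  shows "Root G \<noteq> {}"
proof -
  have "Root G \<in> sccs G"
    using rooted_imp_root_component[OF assms] by (simp add: root_component_def)
  then show ?thesis
    unfolding sccs_def by (auto elim!: quotientE)
qed

lemma In_nbrs_Root: "rooted G \<Longrightarrow> p \<in> Root G \<Longrightarrow> In_nbrs G p \<subseteq> Root G"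
  using rooted_imp_root_component unfolding root_component_def In_nbrs_def by blast

lemma view_of_Suc_cong:
  assumes "In_nbrs (\<sigma> (Suc r)) p = In_nbrs (\<tau> (Suc r)) p"
    and "\<And>q. q \<in> In_nbrs (\<sigma> (Suc r)) p \<Longrightarrow> view_of \<sigma> x q r = view_of \<tau> y q r"
  shows "view_of \<sigma> x p (Suc r) = view_of \<tau> y p (Suc r)"
proof -
  have "(\<lambda>q. view_of \<sigma> x q r) |`| ffilter (\<lambda>q. q \<in> In_nbrs (\<sigma> (Suc r)) p) fUNIV =
        (\<lambda>q. view_of \<tau> y q r) |`| ffilter (\<lambda>q. q \<in> In_nbrs (\<tau> (Suc r)) p) fUNIV"
    using assms by (intro fimage_cong) auto
  then show ?thesis by simp
qed

lemma view_of_prefix_cong: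
  assumes "\<And>s. 1 \<le> s \<Longrightarrow> s \<le> r \<Longrightarrow> \<sigma> s = \<tau> s"
  shows "view_of \<sigma> x p r = view_of \<tau> x p r"
  using assms
proof (induction r arbitrary: p)
  case (Suc r)
  have "\<sigma> (Suc r) = \<tau> (Suc r)"
    by (rule Suc.prems) auto
  then show ?case
    by (intro view_of_Suc_cong Suc.IH Suc.prems) auto
qed simp

text \<open>Nothing from outside \<open>S\<close> can enter after round \<open>j\<close>, so
  \<open>S\<close> never notices differences there. It serves both for graphs differing in one round
  and, with \<open>j = 0\<close>, for differing inputs.\<close>

lemma view_of_closed_cong:
  assumes "j \<le> r" and "p \<in> S"
    and "\<And>s. j < s \<Longrightarrow> \<sigma> s = \<tau> s"
    and "\<And>s q. j < s \<Longrightarrow> q \<in> S \<Longrightarrow> In_nbrs (\<sigma> s) q \<subseteq> S"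
    and "\<And>q. q \<in> S \<Longrightarrow> view_of \<sigma> x q j = view_of \<tau> y q j"
  shows "view_of \<sigma> x p r = view_of \<tau> y p r"
  using assms(1,2)
proof (induction r arbitrary: p rule: dec_induct)
  case base
  then show ?case by (rule assms(5))
next
  case (step r)
  show ?case
  proof (rule view_of_Suc_cong)
    show "In_nbrs (\<sigma> (Suc r)) p = In_nbrs (\<tau> (Suc r)) p"
      using assms(3)[of "Suc r"] step.hyps by simp
    show "view_of \<sigma> x q r = view_of \<tau> y q r" if "q \<in> In_nbrs (\<sigma> (Suc r)) p" for q
      using that assms(4)[of "Suc r" p] step by auto
  qed
qed

lemma refined_graph_1 [simp]: "refined_graph D (Suc 0) = indist_graph D"
  by (simp add: refined_graph_def)

lemma refined_graph_Suc: "m \<ge> 1 \<Longrightarrow> refined_graph D (Suc m) = refine D (refined_graph D m)"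
  by (cases m) (simp_all add: refined_graph_def)

lemma refined_graph_subset: "m \<ge> 1 \<Longrightarrow> refined_graph D m \<subseteq> indist_graph D"
proof (induction m rule: dec_induct)
  case (step m)
  then show ?case
    by (auto simp: refined_graph_Suc refine_def)
qed simp

lemma sym_refined_graph: "m \<ge> 1 \<Longrightarrow> sym (refined_graph D m)"
proof (induction m rule: dec_induct)
  case base
  show ?case
    by (auto simp: sym_def indist_graph_def label_def)
next
  case (step m)
  have "label G H = label H G" for G H :: "'a rel"
    by (auto simp: label_def)
  then show ?case
    using step.hyps symD[OF step.IH] unfolding sym_def
    by (simp add: refined_graph_Suc refine_def) metis
qed

text \<open>Components are forward images of a representative under \<open>E\<^sup>*\<close>;
  symmetry provides the way back to it.\<close>

lemma same_component:
  assumes "sym E" "C \<in> conn_components D E" "G \<in> C" "H \<in> C"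
  shows "(G, H) \<in> E\<^sup>*"
proof -
  obtain G0 where "C = E\<^sup>* `` {G0}"
    using assms(2) by (auto simp: conn_components_def elim: quotientE)
  with assms(3,4) have "(G0, G) \<in> E\<^sup>*" "(G0, H) \<in> E\<^sup>*"
    by auto
  with sym_rtrancl[OF assms(1)] show ?thesis
    by (meson symD rtrancl_trans)
qed

lemma component_subset:
  assumes "E \<subseteq> D \<times> D" "C \<in> conn_components D E"
  shows "C \<subseteq> D"
proof -
  obtain G0 where "G0 \<in> D" "C = E\<^sup>* `` {G0}"
    using assms(2) by (auto simp: conn_components_def elim: quotientE)
  moreover have "H \<in> D" if "(G, H) \<in> E\<^sup>*" "G \<in> D" for G H
    using that by (induction rule: rtrancl_induct) (use assms(1) in auto)
  ultimately show ?thesis by auto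
qed

text \<open>The sets are peeled off one at a time: a hybrid of \<open>x\<close> and \<open>y\<close>
  that follows \<open>x\<close> on \<open>A\<close> agrees with \<open>y\<close> wherever the
  remaining sets intersect.\<close>

lemma depends_only_on_Inter:
  assumes "finite F"
    and "\<And>A x y. A \<in> F \<Longrightarrow> (\<And>p. p \<in> A \<Longrightarrow> x p = y p) \<Longrightarrow> f x = f y"
    and "\<And>p. p \<in> \<Inter>F \<Longrightarrow> x p = y p"
  shows "f x = f y"
  using assms
proof (induction F arbitrary: x rule: finite_induct)
  \<comment> \<open>The intersection of no sets is \<open>UNIV\<close>.\<close>
  case empty
  then have "x = y" by auto
  then show ?case by simp
next
  case (insert A F)
  define z where "z = (\<lambda>p. if p \<in> A then x p else y p)"
  have "f x = f z"
    by (rule insert.prems(1)[of A]) (auto simp: z_def)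
  also have "f z = f y"
  proof (rule insert.IH)
    show "f u = f w" if "B \<in> F" "\<And>p. p \<in> B \<Longrightarrow> u p = w p" for B u w
      using that insert.prems(1)[of B u w] by auto
    show "z p = y p" if "p \<in> \<Inter>F" for p
      using that insert.prems(2)[of p] by (auto simp: z_def)
  qed
  finally show ?case .
qed

text \<open>The tail is infinite so that the result is again an admissible pattern; decisions at
  round \<open>i\<close> see only its first \<open>i - j\<close> graphs.\<close>

definition switch :: "(nat \<Rightarrow> 'g) \<Rightarrow> nat \<Rightarrow> 'g \<Rightarrow> nat \<Rightarrow> 'g" where
  "switch \<tau> j G = (\<lambda>r. if r \<le> j then \<tau> r else G)"

lemma switch_admissible: "\<tau> \<in> admissible D \<Longrightarrow> G \<in> D \<Longrightarrow> switch \<tau> j G \<in> admissible D"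
  by (auto simp: switch_def admissible_def)

text \<open>Lets the induction hypothesis for the shorter tail, with \<open>G\<close> moved into the
  prefix, speak about the longer tail.\<close>

lemma switch_Suc: "switch (\<tau>(Suc j := G)) (Suc j) G = switch \<tau> j G"
  by (auto simp: switch_def fun_eq_iff)

lemma view_of_switch_label:
  assumes "p \<in> label G H"
  shows "view_of (switch \<tau> j G) x p (Suc j) = view_of (switch \<tau> j H) x p (Suc j)"
proof (rule view_of_Suc_cong)
  show "view_of (switch \<tau> j G) x q j = view_of (switch \<tau> j H) x q j" for q
    by (rule view_of_prefix_cong) (simp add: switch_def)
qed (use assms in \<open>simp add: switch_def label_def\<close>)

text \<open>\<open>f \<sigma> x\<close> is the value decided under \<open>\<sigma>\<close> with inputs \<open>x\<close>.\<close>

lemma decision_invariant: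
  fixes D :: "('p::finite) rel set"
  assumes rooted: "\<And>G. G \<in> D \<Longrightarrow> rooted G"
    and indist: "\<And>\<sigma> \<sigma>' p. \<sigma> \<in> admissible D \<Longrightarrow> \<sigma>' \<in> admissible D \<Longrightarrow>
      view_of \<sigma> x p i = view_of \<sigma>' x p i \<Longrightarrow> f \<sigma> = f \<sigma>'"
    and "m \<ge> 1" "j + m = i" "\<tau> \<in> admissible D" "(G, H) \<in> (refined_graph D m)\<^sup>*" "G \<in> D"
  shows "f (switch \<tau> j G) = f (switch \<tau> j H)"
  using assms(3-)
proof (induction m arbitrary: j \<tau> G H rule: dec_induct)
  case base
  \<comment> \<open>As \<open>i = j + 1\<close>, one process in the label suffices: it sees no
    difference up to round \<open>i\<close>.\<close>
  have edge: "f (switch \<tau> j G) = f (switch \<tau> j H)" if "(G, H) \<in> indist_graph D" for G H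
  proof -
    from that obtain p where "p \<in> label G H" and D: "G \<in> D" "H \<in> D"
      by (auto simp: indist_graph_def)
    then have "view_of (switch \<tau> j G) x p i = view_of (switch \<tau> j H) x p i"
      using view_of_switch_label[of p G H \<tau> j x] base.prems(1) by auto
    then show ?thesis
      using D base.prems(2) by (intro indist[of _ _ p] switch_admissible)
  qed
  show ?case
    using base.prems(3) unfolding One_nat_def refined_graph_1
    by (induction rule: rtrancl_induct) (use edge in auto)
next
  case (step m)
  let ?E = "refined_graph D m"
  have sub: "?E \<subseteq> D \<times> D"
    using refined_graph_subset[of m D] step.hyps by (auto simp: indist_graph_def)
  have edge: "f (switch \<tau> j G) = f (switch \<tau> j H)" if "(G, H) \<in> refine D ?E" for G H
  proof -
    from that obtain C K where C: "C \<in> conn_components D ?E" "G \<in> C" "H \<in> C" "K \<in> C"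
      and K: "Root K \<subseteq> label G H"
      by (auto simp: refine_def)
    then have D: "G \<in> D" "H \<in> D" "K \<in> D"
      using component_subset[OF sub] by auto
    have path: "(G, K) \<in> ?E\<^sup>*" "(H, K) \<in> ?E\<^sup>*"
      using same_component[OF sym_refined_graph] C step.hyps by auto
    \<comment> \<open>\<open>A\<close> is played in round \<open>j + 1\<close> only, and
      \<open>K\<close> ever after.\<close>
    define \<sigma> where "\<sigma> = (\<lambda>A. switch (\<tau>(Suc j := A)) (Suc j) K)"
    have adm: "\<tau>(Suc j := A) \<in> admissible D" if "A \<in> D" for A
      using step.prems(2) that by (auto simp: admissible_def)
    \<comment> \<open>The induction hypothesis is applied to the prefix extended by
      \<open>A\<close>, so only the tail changes.\<close>
    have to_K: "f (switch \<tau> j A) = f (\<sigma> A)" if "A \<in> D" "(A, K) \<in> ?E\<^sup>*" for A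
      using step.IH[OF _ adm[OF that(1)] that(2,1), of "Suc j"] step.prems(1)
      unfolding switch_Suc \<sigma>_def add_Suc add_Suc_right by blast
    obtain p where p: "p \<in> Root K"
      using Root_nonempty rooted D(3) by blast
    have "view_of (\<sigma> G) x p i = view_of (\<sigma> H) x p i"
    proof (rule view_of_closed_cong)
      show "Suc j \<le> i" using step.prems(1) by simp
      show "In_nbrs (\<sigma> G s) q \<subseteq> Root K" if "Suc j < s" "q \<in> Root K" for s q
        using that In_nbrs_Root[of K] rooted D(3) by (auto simp: \<sigma>_def switch_def)
      show "view_of (\<sigma> G) x q (Suc j) = view_of (\<sigma> H) x q (Suc j)" if "q \<in> Root K" for q
      proof -
        have *: "view_of (\<sigma> A) x q (Suc j) = view_of (switch \<tau> j A) x q (Suc j)" for A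
          by (rule view_of_prefix_cong) (auto simp: \<sigma>_def switch_def)
        show ?thesis
          unfolding * using view_of_switch_label K that by blast
      qed
    qed (use p in \<open>simp_all add: \<sigma>_def switch_def\<close>)
    moreover have "\<sigma> A \<in> admissible D" if "A \<in> D" for A
      unfolding \<sigma>_def using adm[OF that] D(3) by (rule switch_admissible)
    ultimately have "f (\<sigma> G) = f (\<sigma> H)"
      using D indist by blast
    with to_K D path show ?thesis by simp
  qed
  have "(G, H) \<in> (refine D ?E)\<^sup>*"
    using step.prems(3) step.hyps by (simp add: refined_graph_Suc)
  then show ?case
    by (induction rule: rtrancl_induct) (use edge in auto)
qed

theorem theorem2:
  fixes D :: "('p::finite) rel set"
    and i :: nat
    and \<Delta> :: "('p, 'v::finite) decision_functions"
  assumes "D \<noteq> {}"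
    and "\<forall>G \<in> D. comm_graph G \<and> rooted G"
    and "card (UNIV :: 'v set) \<ge> 2"
    and "i \<ge> 1"
    and "\<exists>C \<in> conn_components D (refined_graph D i). \<not> root_compatible C"
    and "consensus_algorithm D \<Delta>"
    and "correct D \<Delta>"
  shows "\<not> (\<forall>\<sigma> \<in> admissible D. \<forall>x p. \<exists>v. decided_by \<Delta> \<sigma> x p i v)"
proof
  assume dec: "\<forall>\<sigma> \<in> admissible D. \<forall>x p. \<exists>v. decided_by \<Delta> \<sigma> x p i v"
  \<comment> \<open>\<open>undefined\<close> is just some process; by agreement the choice is
    immaterial.\<close>
  define f where "f = (\<lambda>\<sigma> x. \<Delta> undefined (view_of \<sigma> x undefined i))"
  have f: "f \<sigma> x = \<Delta> p (view_of \<sigma> x p i)" if \<sigma>: "\<sigma> \<in> admissible D" for \<sigma> x p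
  proof -
    obtain v w where "decided_by \<Delta> \<sigma> x undefined i v" "decided_by \<Delta> \<sigma> x p i w"
      using dec \<sigma> by blast
    moreover from this have "v = w"
      using assms(7) \<sigma> unfolding correct_def sat_agreement_def by blast
    ultimately show ?thesis
      by (simp add: f_def decided_by_def)
  qed
  obtain C where C: "C \<in> conn_components D (refined_graph D i)" "\<not> root_compatible C"
    using assms(5) by blast
  have "refined_graph D i \<subseteq> D \<times> D"
    using refined_graph_subset[OF assms(4), of D] by (auto simp: indist_graph_def)
  from component_subset[OF this C(1)] have "C \<subseteq> D" .
  \<comment> \<open>An empty \<open>C\<close> would have intersection \<open>UNIV\<close> and be
    root-compatible.\<close>
  obtain G0 where G0: "G0 \<in> C"
    using C(2) by (auto simp: root_compatible_def)
  have const: "(\<lambda>_. G) \<in> admissible D" if "G \<in> D" for G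
    using that by (simp add: admissible_def)
  have same: "f (\<lambda>_. G) x = f (\<lambda>_. G0) x" if "G \<in> C" for G x
  proof -
    have "f (switch (\<lambda>_. G0) 0 G) x = f (switch (\<lambda>_. G0) 0 G0) x"
    proof (rule decision_invariant[where f = "\<lambda>\<sigma>. f \<sigma> x"])
      show "f \<sigma> x = f \<sigma>' x"
        if "\<sigma> \<in> admissible D" "\<sigma>' \<in> admissible D" "view_of \<sigma> x p i = view_of \<sigma>' x p i"
        for \<sigma> \<sigma>' p
        using that f[of _ x p] by simp
      show "(G, G0) \<in> (refined_graph D i)\<^sup>*"
        using same_component[OF sym_refined_graph C(1)] assms(4) that G0 by blast
    qed (use assms(2,4) \<open>C \<subseteq> D\<close> that G0 const in auto)
    \<comment> \<open>The two patterns can differ only at index 0, which no view reads.\<close>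
    moreover have "f (switch (\<lambda>_. G0) 0 A) x = f (\<lambda>_. A) x" for A
      unfolding f_def by (subst view_of_prefix_cong[of _ _ "\<lambda>_. A"]) (auto simp: switch_def)
    ultimately show ?thesis by simp
  qed
  have root_dep: "f (\<lambda>_. G0) x = f (\<lambda>_. G0) y"
    if "G \<in> C" "\<And>p. p \<in> Root G \<Longrightarrow> x p = y p" for G x y
  proof -
    have G: "G \<in> D" "rooted G"
      using that \<open>C \<subseteq> D\<close> assms(2) by auto
    then obtain p where p: "p \<in> Root G"
      using Root_nonempty by blast
    have "view_of (\<lambda>_. G) x p i = view_of (\<lambda>_. G) y p i"
      by (rule view_of_closed_cong[where j = 0 and S = "Root G"])
        (use p G that In_nbrs_Root[of G] in auto)
    then have "f (\<lambda>_. G) x = f (\<lambda>_. G) y"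
      using f[OF const[OF G(1)], of _ p] by simp
    then show ?thesis
      using same[OF that(1)] by simp
  qed
  \<comment> \<open>The roots in \<open>C\<close> have empty intersection, so agreement of
    \<open>x\<close> and \<open>y\<close> on it is vacuous.\<close>
  have f_const: "f (\<lambda>_. G0) x = f (\<lambda>_. G0) y" for x y
    by (rule depends_only_on_Inter[of "Root ` C"])
      (use root_dep C(2) in \<open>auto simp: root_compatible_def\<close>)
  obtain a b :: 'v where "a \<noteq> b"
    using assms(3) by (metis obtain_subset_with_card_n card_2_iff)
  \<comment> \<open>With all inputs equal to \<open>c\<close>, validity leaves no other
    value.\<close>
  have "f (\<lambda>_. G0) (\<lambda>_. c) = Some c" for c
  proof -
    have "(\<lambda>_. G0) \<in> admissible D"
      using const G0 \<open>C \<subseteq> D\<close> by blast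
    moreover from this obtain v where v: "decided_by \<Delta> (\<lambda>_. G0) (\<lambda>_. c) undefined i v"
      using dec by blast
    ultimately have "v = c"
      using assms(7) unfolding correct_def sat_validity_def by blast
    with v show ?thesis
      by (simp add: f_def decided_by_def)
  qed
  with f_const[of "\<lambda>_. a" "\<lambda>_. b"] \<open>a \<noteq> b\<close> show False
    by simp
qed

end
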